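(* Let $m\ge 2$ and let $G_0,\dots,G_{m-1}$ (indices in $\mathbb{Z}_m$) be $4$-graphs with vertex partitions $V(G_i)=V_i'\cup V_i''$. Suppose that for every $i\in\mathbb{Z}_m$ there is an integer $\alpha_i$ with $\alpha(G_i)=\alpha_i+1$ and $\alpha(G_i\cap V_i')\le\alpha_i$. Then $\alpha(C_m[G_0,\dots,G_{m-1}])\le\sum_{i\in\mathbb{Z}_m}\alpha_i$.
   Context: A $4$-graph has a finite vertex set and edges which are $4$-element vertex subsets; $\alpha(\cdot)$ is the maximum size of a vertex set containing no edge; $G\cap U$ denotes the subgraph of $G$ induced by $U$. Circular construction: given $4$-graphs $G_i$, $i\in\mathbb{Z}_m$ ($m\ge2$), with $V(G_i)=V_i'\cup V_i''$ (disjoint), let $W_i=V_i'\times V_{i+1}''$ (the sets $W_i$ regarded as pairwise disjoint), and for $x\in V_i'$ let $W_{i,x}=\{(x,y):y\in V_{i+1}''\}$. For $A\subseteq\bigcup_i W_i$, $\beta_i(A)$ is the number of $x\in V_i'$ with $W_{i,x}\cap A\neq\emptyset$. Define $h_i:W_i\cup W_{i+1}\to V(G_{i+1})$ by $h_i((x,y))=y\in V_{i+1}''$ if $(x,y)\in W_i$ and $h_i((x,y))=x\in V_{i+1}'$ if $(x,y)\in W_{i+1}$. Let $E_i^1$ be the set of $4$-sets $\{w_1,\dots,w_4\}\subseteq W_i\cup W_{i+1}$ with $\beta_i(\{w_1,\dots,w_4\})=1$ such that $h_i(w_1),\dots,h_i(w_4)$ form an edge of $G_{i+1}$. Let $E_i^2$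 be the set of $4$-sets $\{w_1,\dots,w_4\}\subseteq W_i$, $w_j=(x_j,y_j)$, with $x_1=x_2$ and $x_3=x_4\ne x_1$. Let $E_i^4$ be the set of $4$-sets $\{w_1,\dots,w_4\}\subseteq W_i$, $w_j=(x_j,y_j)$, with $x_1,\dots,x_4$ pairwise distinct forming an edge of $G_i$. Then $C_m[G_0,\dots,G_{m-1}]$ is the $4$-graph with vertex set $\bigcup_{i\in\mathbb{Z}_m}W_i$ and edge set $\bigcup_{i\in\mathbb{Z}_m}(E_i^1\cup E_i^2\cup E_i^4)$. *)

theory Defs
  imports Main
begin

record 'a hypergraph =
  verts :: "'a set"
  edges :: "'a set set"

definition four_graph :: "'a hypergraph \<Rightarrow> bool" where
  "four_graph G \<longleftrightarrow> finite (verts G) \<and> (\<forall>e \<in> edges G. e \<subseteq> verts G \<and> card e = 4)"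

definition independent :: "'a hypergraph \<Rightarrow> 'a set \<Rightarrow> bool" where
  "independent G S \<longleftrightarrow> S \<subseteq> verts G \<and> (\<forall>e \<in> edges G. \<not> e \<subseteq> S)"

definition independence_number :: "'a hypergraph \<Rightarrow> nat" where
  "independence_number G = Max {card S | S. independent G S}"

definition induced :: "'a hypergraph \<Rightarrow> 'a set \<Rightarrow> 'a hypergraph" where
  "induced G U = \<lparr>verts = verts G \<inter> U, edges = {e \<in> edges G. e \<subseteq> U}\<rparr>"

text \<open>
  The index set \<open>\<int>\<^sub>m\<close> is represented by \<open>{..<m}\<close>, with \<open>nxt m i\<close> standing for \<open>i + 1\<close>.
  In the construction below, \<open>P i\<close> and \<open>Q i\<close> are the two parts \<open>V\<^sub>i'\<close> and \<open>V\<^sub>i''\<close> of the vertex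
  set of \<open>G i\<close>.  A pair \<open>(x, y)\<close> of \<open>W\<^sub>i\<close> is represented by the triple \<open>(i, x, y)\<close>, so that
  the sets \<open>W\<^sub>i\<close> are pairwise disjoint even if the graphs \<open>G i\<close> share vertices.
\<close>

definition nxt :: "nat \<Rightarrow> nat \<Rightarrow> nat" where
  "nxt m i = Suc i mod m"

type_synonym 'a cvertex = "nat \<times> 'a \<times> 'a"

fun xcoord :: "'a cvertex \<Rightarrow> 'a" where
  "xcoord (i, x, y) = x"

definition W :: "nat \<Rightarrow> (nat \<Rightarrow> 'a set) \<Rightarrow> (nat \<Rightarrow> 'a set) \<Rightarrow> nat \<Rightarrow> 'a cvertex set" where
  "W m P Q i = {(i, x, y) | x y. x \<in> P i \<and> y \<in> Q (nxt m i)}"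

definition W_fibre :: "nat \<Rightarrow> (nat \<Rightarrow> 'a set) \<Rightarrow> nat \<Rightarrow> 'a \<Rightarrow> 'a cvertex set" where
  "W_fibre m Q i x = {(i, x, y) | y. y \<in> Q (nxt m i)}"

definition beta ::
  "nat \<Rightarrow> (nat \<Rightarrow> 'a set) \<Rightarrow> (nat \<Rightarrow> 'a set) \<Rightarrow> nat \<Rightarrow> 'a cvertex set \<Rightarrow> nat" where
  "beta m P Q i A = card {x \<in> P i. W_fibre m Q i x \<inter> A \<noteq> {}}"

text \<open>
  The map \<open>h i\<close> is only used on \<open>W m P Q i \<union> W m P Q (nxt m i)\<close>.  The two index tags differ
  because \<open>m \<ge> 2\<close>, so the second branch applies exactly to the elements of \<open>W m P Q (nxt m i)\<close>.
\<close>

fun h :: "nat \<Rightarrow> 'a cvertex \<Rightarrow> 'a" where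
  "h i (j, x, y) = (if j = i then y else x)"

definition E1 ::
  "nat \<Rightarrow> (nat \<Rightarrow> 'a hypergraph) \<Rightarrow> (nat \<Rightarrow> 'a set) \<Rightarrow> (nat \<Rightarrow> 'a set) \<Rightarrow> nat \<Rightarrow> 'a cvertex set set"
  where
  "E1 m G P Q i = {{w1, w2, w3, w4} | w1 w2 w3 w4.
     distinct [w1, w2, w3, w4] \<and>
     {w1, w2, w3, w4} \<subseteq> W m P Q i \<union> W m P Q (nxt m i) \<and>
     beta m P Q i {w1, w2, w3, w4} = 1 \<and>
     {h i w1, h i w2, h i w3, h i w4} \<in> edges (G (nxt m i))}"

definition E2 ::
  "nat \<Rightarrow> (nat \<Rightarrow> 'a set) \<Rightarrow> (nat \<Rightarrow> 'a set) \<Rightarrow> nat \<Rightarrow> 'a cvertex set set" where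
  "E2 m P Q i = {{w1, w2, w3, w4} | w1 w2 w3 w4.
     distinct [w1, w2, w3, w4] \<and>
     {w1, w2, w3, w4} \<subseteq> W m P Q i \<and>
     xcoord w1 = xcoord w2 \<and> xcoord w3 = xcoord w4 \<and> xcoord w3 \<noteq> xcoord w1}"

definition E4 ::
  "nat \<Rightarrow> (nat \<Rightarrow> 'a hypergraph) \<Rightarrow> (nat \<Rightarrow> 'a set) \<Rightarrow> (nat \<Rightarrow> 'a set) \<Rightarrow> nat \<Rightarrow> 'a cvertex set set"
  where
  "E4 m G P Q i = {{w1, w2, w3, w4} | w1 w2 w3 w4.
     {w1, w2, w3, w4} \<subseteq> W m P Q i \<and>
     distinct [xcoord w1, xcoord w2, xcoord w3, xcoord w4] \<and>
     {xcoord w1, xcoord w2, xcoord w3, xcoord w4} \<in> edges (G i)}"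

definition circular ::
  "nat \<Rightarrow> (nat \<Rightarrow> 'a hypergraph) \<Rightarrow> (nat \<Rightarrow> 'a set) \<Rightarrow> (nat \<Rightarrow> 'a set) \<Rightarrow> 'a cvertex hypergraph" where
  "circular m G P Q =
     \<lparr>verts = (\<Union>i<m. W m P Q i),
      edges = (\<Union>i<m. E1 m G P Q i \<union> E2 m P Q i \<union> E4 m G P Q i)\<rparr>"

lemma four_graph_circular:
  assumes "m \<ge> 2"
    and "\<And>i. i < m \<Longrightarrow> four_graph (G i)"
    and "\<And>i. i < m \<Longrightarrow> verts (G i) = P i \<union> Q i"
  shows "four_graph (circular m G P Q)"
proof -
  have nxt: "nxt m i < m" for i
    using assms(1) by (simp add: nxt_def)
  have fin: "finite (P i) \<and> finite (Q i)" if "i < m" for i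
    using assms(2,3)[OF that] by (simp add: four_graph_def)
  have "finite (W m P Q i)" if "i < m" for i
  proof -
    have "W m P Q i \<subseteq> {i} \<times> P i \<times> Q (nxt m i)"
      by (auto simp: W_def)
    then show ?thesis
      using fin[OF that] fin[OF nxt] by (meson finite.emptyI finite.insertI finite_SigmaI finite_subset)
  qed
  moreover have "e \<subseteq> (\<Union>i<m. W m P Q i) \<and> card e = 4"
    if "i < m" and e: "e \<in> E1 m G P Q i \<union> E2 m P Q i \<union> E4 m G P Q i" for e i
  proof -
    have "\<exists>w1 w2 w3 w4. e = {w1, w2, w3, w4} \<and> distinct [w1, w2, w3, w4] \<and>
        {w1, w2, w3, w4} \<subseteq> W m P Q i \<union> W m P Q (nxt m i)"
      using e
    proof (elim UnE)
      assume "e \<in> E1 m G P Q i"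
      then show ?thesis unfolding E1_def mem_Collect_eq by (elim exE conjE) (intro exI conjI)
    next
      assume "e \<in> E2 m P Q i"
      then show ?thesis unfolding E2_def mem_Collect_eq
        by (elim exE conjE) (intro exI conjI, assumption, assumption, rule le_supI1)
    next
      assume "e \<in> E4 m G P Q i"
      then obtain w1 w2 w3 w4 where "e = {w1, w2, w3, w4}" "{w1, w2, w3, w4} \<subseteq> W m P Q i"
        "distinct (map xcoord [w1, w2, w3, w4])"
        unfolding E4_def mem_Collect_eq by (elim exE conjE) simp
      moreover from this(3) have "distinct [w1, w2, w3, w4]"
        unfolding distinct_map by (rule conjunct1)
      ultimately show ?thesis by (intro exI conjI) (assumption, assumption, rule le_supI1)
    qed
    then obtain w1 w2 w3 w4 where w: "e = {w1, w2, w3, w4}" "distinct [w1, w2, w3, w4]"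
      and sub: "{w1, w2, w3, w4} \<subseteq> W m P Q i \<union> W m P Q (nxt m i)"
      by (elim exE conjE)
    have "card e = 4"
      using distinct_card[OF w(2)] w(1) by simp
    moreover have "e \<subseteq> (\<Union>i<m. W m P Q i)"
      using sub that(1) nxt[of i] unfolding w(1) by blast
    ultimately show ?thesis by (rule conjI[rotated])
  qed
  ultimately show ?thesis
    unfolding four_graph_def circular_def by simp
qed

end

theory Submission
  imports Defs
begin

text \<open>
  Let \<open>A\<close> be independent in the circular graph, and let \<open>X\<^sub>i\<close> be the set of first coordinates of
  \<open>A \<inter> W\<^sub>i\<close>.  The edges in \<open>E\<^sub>i\<^sup>4\<close> make \<open>X\<^sub>i\<close> independent in \<open>G\<^sub>i\<close>, and those in \<open>E\<^sub>i\<^sup>2\<close> allow at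
  most one fibre of \<open>A \<inter> W\<^sub>i\<close> to have two or more elements.  If \<open>Y\<close> is the set of second coordinates
  of a largest fibre, the edges in \<open>E\<^sub>i\<^sup>1\<close> make \<open>Y \<union> X\<^sub>i\<^sub>+\<^sub>1\<close> independent in \<open>G\<^sub>i\<^sub>+\<^sub>1\<close>.  Hence
  \<open>|A \<inter> W\<^sub>i| \<le> |X\<^sub>i| - 1 + |Y| \<le> |X\<^sub>i| + \<alpha>\<^sub>i\<^sub>+\<^sub>1 - |X\<^sub>i\<^sub>+\<^sub>1|\<close>, and the sum over the cycle telescopes.
\<close>

lemma finite_independent_cards:
  assumes "finite (verts G)"
  shows "finite {card S | S. independent G S}"
proof -
  have "{card S | S. independent G S} \<subseteq> card ` Pow (verts G)"
    by (auto simp: independent_def)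
  then show ?thesis
    using assms by (meson finite_Pow_iff finite_imageI finite_subset)
qed

lemma card_le_independence_number:
  assumes "finite (verts G)" and "independent G S"
  shows "card S \<le> independence_number G"
  unfolding independence_number_def
  using assms by (intro Max_ge finite_independent_cards) auto

text \<open>Edges have four elements, so the empty set is independent and the \<open>Max\<close>
  ranges over a nonempty finite set.\<close>

lemma independence_number_attained:
  assumes "four_graph G"
  obtains S where "independent G S" and "card S = independence_number G"
proof -
  have "independent G {}"
    using assms by (auto simp: independent_def four_graph_def)
  then have "independence_number G \<in> {card S | S. independent G S}"
    unfolding independence_number_def
    using assms by (intro Max_in finite_independent_cards) (auto simp: four_graph_def)
  then show thesis
    using that by auto
qed

lemma independent_induced:
  assumes "independent G S" and "S \<subseteq> U"
  shows "independent (induced G U) S"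
  using assms by (auto simp: independent_def induced_def)

lemma card_4_obtain:
  assumes "card e = 4"
  obtains a b c d where "e = {a, b, c, d}" and "distinct [a, b, c, d]"
proof -
  have "finite e"
    using assms by (intro card_ge_0_finite) simp
  then obtain zs where zs: "set zs = e" "distinct zs" "length zs = 4"
    using assms by (metis finite_distinct_list distinct_card)
  then obtain a b c d where "zs = [a, b, c, d]"
    by (auto simp: numeral_eq_Suc length_Suc_conv)
  then show thesis
    using zs that by auto
qed

text \<open>\<open>nxt m\<close> rotates the cycle: it shifts every index below the last one up by
  one and sends the last to 0.\<close>

lemma sum_nxt: "(\<Sum>i<m. f (nxt m i)) = (\<Sum>i<m. f i)"
proof (cases m)
  case (Suc n)
  have "(\<Sum>i<n. f (nxt m i)) = (\<Sum>i<n. f (Suc i))"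
    using Suc by (intro sum.cong) (auto simp: nxt_def)
  moreover have "nxt m n = 0"
    using Suc by (simp add: nxt_def)
  ultimately show ?thesis
    unfolding Suc sum.lessThan_Suc_shift[of f n] using Suc by (simp add: add.commute)
qed simp

lemma nxt_neq:
  assumes "m \<ge> 2" and "i < m"
  shows "nxt m i \<noteq> i"
  using assms by (cases "Suc i = m") (auto simp: nxt_def)

text \<open>This is \<open>X\<^sub>i\<close> of the overview. For \<open>A\<close> inside the vertex
  set of the circular graph, its size is \<open>beta m P Q i A\<close>.\<close>

definition supp :: "'a cvertex set \<Rightarrow> nat \<Rightarrow> 'a set" where
  "supp A i = {x. \<exists>y. (i, x, y) \<in> A}"

definition fibre :: "'a cvertex set \<Rightarrow> nat \<Rightarrow> 'a \<Rightarrow> 'a set" where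
  "fibre A i x = {y. (i, x, y) \<in> A}"

lemma circular_subset_W:
  assumes "A \<subseteq> verts (circular m G P Q)" and "(i, x, y) \<in> A"
  shows "(i, x, y) \<in> W m P Q i"
  using assms by (auto simp: circular_def W_def)

text \<open>Choosing one point of \<open>A\<close> over each vertex of an edge inside
  \<open>supp A i\<close> lifts that edge to a member of \<open>E4\<close> inside
  \<open>A\<close>.\<close>

lemma independent_supp:
  assumes "four_graph (G i)" and "verts (G i) = P i \<union> Q i" and "i < m"
    and A: "independent (circular m G P Q) A"
  shows "independent (G i) (supp A i)"
  unfolding independent_def
proof (intro conjI ballI notI)
  have W: "(i, x, y) \<in> W m P Q i" if "(i, x, y) \<in> A" for x y
    using A that circular_subset_W by (metis independent_def)
  show "supp A i \<subseteq> verts (G i)"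
    using W assms(2) by (auto simp: supp_def W_def)
  fix e assume e: "e \<in> edges (G i)" "e \<subseteq> supp A i"
  then have "\<forall>x\<in>e. \<exists>y. (i, x, y) \<in> A"
    by (auto simp: supp_def)
  then obtain \<eta> where \<eta>: "\<And>x. x \<in> e \<Longrightarrow> (i, x, \<eta> x) \<in> A"
    by metis
  have "card e = 4"
    using e assms(1) by (auto simp: four_graph_def)
  then obtain x1 x2 x3 x4 where x: "e = {x1, x2, x3, x4}" "distinct [x1, x2, x3, x4]"
    by (rule card_4_obtain)
  let ?w = "\<lambda>x. (i, x, \<eta> x)"
  have "{?w x1, ?w x2, ?w x3, ?w x4} \<in> E4 m G P Q i"
    unfolding E4_def mem_Collect_eq
    using x e(1) \<eta> W
    by (intro exI[of _ "?w x1"] exI[of _ "?w x2"] exI[of _ "?w x3"] exI[of _ "?w x4"]) auto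
  then have "{?w x1, ?w x2, ?w x3, ?w x4} \<in> edges (circular m G P Q)"
    using assms(3) by (auto simp: circular_def)
  moreover have "{?w x1, ?w x2, ?w x3, ?w x4} \<subseteq> A"
    using x \<eta> by auto
  ultimately show False
    using A by (auto simp: independent_def)
qed

text \<open>If the smaller fibre had two points, so would the larger, and two points from each would
  form a member of \<open>E2\<close> inside \<open>A\<close>.\<close>

lemma card_fibre_le_1:
  assumes "i < m" and A: "independent (circular m G P Q) A"
    and fin: "finite (fibre A i x)" "finite (fibre A i x')"
    and "x \<noteq> x'" and "card (fibre A i x') \<le> card (fibre A i x)"
  shows "card (fibre A i x') \<le> 1"
proof (rule ccontr)
  assume "\<not> card (fibre A i x') \<le> 1"
  then have "\<not> card (fibre A i x') \<le> Suc 0" "\<not> card (fibre A i x) \<le> Suc 0"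
    using assms(6) by auto
  then obtain y1 y2 y3 y4 where y: "y1 \<noteq> y2" "(i, x, y1) \<in> A" "(i, x, y2) \<in> A"
    "y3 \<noteq> y4" "(i, x', y3) \<in> A" "(i, x', y4) \<in> A"
    unfolding card_le_Suc0_iff_eq[OF fin(1)] card_le_Suc0_iff_eq[OF fin(2)]
    by (auto simp: fibre_def)
  have W: "(i, x, y) \<in> W m P Q i" if "(i, x, y) \<in> A" for x y
    using A that circular_subset_W by (metis independent_def)
  have "{(i, x, y1), (i, x, y2), (i, x', y3), (i, x', y4)} \<in> E2 m P Q i"
    unfolding E2_def mem_Collect_eq
    using y W assms(5)
    by (intro exI[of _ "(i, x, y1)"] exI[of _ "(i, x, y2)"] exI[of _ "(i, x', y3)"]
        exI[of _ "(i, x', y4)"]) auto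
  then have "{(i, x, y1), (i, x, y2), (i, x', y3), (i, x', y4)} \<in> edges (circular m G P Q)"
    using assms(1) by (auto simp: circular_def)
  then show False
    using A y by (auto simp: independent_def)
qed

text \<open>An edge inside the union lifts to a 4-set inside \<open>A\<close> that meets exactly one
  fibre of \<open>W m P Q i\<close>, hence to a member of \<open>E1\<close>.\<close>

lemma independent_fibre_supp:
  fixes G :: "nat \<Rightarrow> 'a hypergraph"
  assumes "m \<ge> 2" and "i < m" and j: "j = nxt m i"
    and "four_graph (G j)" and V: "verts (G j) = P j \<union> Q j"
    and A: "independent (circular m G P Q) A"
  shows "independent (G j) (fibre A i x \<union> supp A j)"
proof -
  have "j < m"
    using assms(1) j by (simp add: nxt_def)
  have "j \<noteq> i"
    using nxt_neq assms(1,2) j by simp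
  have supp: "independent (G j) (supp A j)"
    using assms(4) V \<open>j < m\<close> A by (rule independent_supp)
  have W: "(k, x, y) \<in> W m P Q k" if "(k, x, y) \<in> A" for k x y
    using A that circular_subset_W by (metis independent_def)
  show ?thesis
    unfolding independent_def
  proof (intro conjI ballI notI)
    show "fibre A i x \<union> supp A j \<subseteq> verts (G j)"
      using W supp V j by (auto simp: fibre_def W_def independent_def)
    fix e assume e: "e \<in> edges (G j)" "e \<subseteq> fibre A i x \<union> supp A j"
    \<comment> \<open>The edge must use the fibre over \<open>x\<close>; otherwise its lift would
      have \<open>beta\<close> equal to 0 instead of 1.\<close>
    then have "\<not> e \<subseteq> supp A j"
      using supp by (auto simp: independent_def)
    then obtain y where y: "y \<in> e" "y \<in> fibre A i x"
      using e by auto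
    have "\<exists>y. (j, z, y) \<in> A" if "z \<in> e - fibre A i x" for z
      using that e by (auto simp: supp_def)
    then obtain \<eta> where \<eta>: "\<And>z. z \<in> e - fibre A i x \<Longrightarrow> (j, z, \<eta> z) \<in> A"
      by metis
    \<comment> \<open>\<open>g\<close> is a right inverse of \<open>h i\<close> with values in
      \<open>A\<close> on \<open>e\<close>. A vertex that lies in both sets is lifted into the
      fibre.\<close>
    define g where "g z = (if z \<in> fibre A i x then (i, x, z) else (j, z, \<eta> z))" for z
    have g: "g z \<in> A" "g z \<in> W m P Q i \<union> W m P Q j" if "z \<in> e" for z
      using that \<eta> W by (auto simp: g_def fibre_def)
    have h: "h i (g z) = z" for z
      using \<open>j \<noteq> i\<close> by (simp add: g_def)
    then have inj: "g z = g z' \<longleftrightarrow> z = z'" for z z'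
      by metis
    have "card e = 4"
      using e assms(4) by (auto simp: four_graph_def)
    then obtain z1 z2 z3 z4 where z: "e = {z1, z2, z3, z4}" "distinct [z1, z2, z3, z4]"
      by (rule card_4_obtain)
    \<comment> \<open>All lifted points with tag \<open>i\<close> have first coordinate
      \<open>x\<close>, and \<open>g y\<close> is one of them.\<close>
    have "{u \<in> P i. W_fibre m Q i u \<inter> g ` e \<noteq> {}} = {x}"
    proof (intro equalityI subsetI)
      fix u assume "u \<in> {u \<in> P i. W_fibre m Q i u \<inter> g ` e \<noteq> {}}"
      then show "u \<in> {x}"
        using \<open>j \<noteq> i\<close> by (auto simp: W_fibre_def g_def split: if_splits)
    next
      fix u assume "u \<in> {x}"
      moreover have "g y = (i, x, y)" "(i, x, y) \<in> W m P Q i"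
        using y W by (auto simp: g_def fibre_def)
      ultimately show "u \<in> {u \<in> P i. W_fibre m Q i u \<inter> g ` e \<noteq> {}}"
        using y(1) by (force simp: W_fibre_def W_def)
    qed
    then have "beta m P Q i (g ` e) = 1"
      by (simp add: beta_def)
    moreover have "g ` e \<subseteq> W m P Q i \<union> W m P Q j"
      using g by blast
    ultimately have "g ` e \<in> E1 m G P Q i"
      unfolding E1_def mem_Collect_eq z(1) image_insert image_empty
      using z(2) e(1)
      by (intro exI[of _ "g z1"] exI[of _ "g z2"] exI[of _ "g z3"] exI[of _ "g z4"])
        (simp add: h inj z(1) flip: j)
    then have "g ` e \<in> edges (circular m G P Q)"
      using assms(2) by (auto simp: circular_def)
    then show False
      using A g by (auto simp: independent_def)
  qed
qed

text \<open>The fibre over \<open>x\<close> is a largest one, so each of the other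
  \<open>card (supp A i) - 1\<close> nonempty fibres has one element. The 1 is added on the left to
  avoid truncated subtraction.\<close>

lemma card_W_le:
  assumes "i < m" and A: "independent (circular m G P Q) A" and fin: "finite A"
    and x: "x \<in> supp A i"
    and max: "\<And>x'. x' \<in> supp A i \<Longrightarrow> card (fibre A i x') \<le> card (fibre A i x)"
  shows "card (A \<inter> W m P Q i) + 1 \<le> card (supp A i) + card (fibre A i x)"
proof -
  have finf: "finite (fibre A i x')" for x'
    unfolding fibre_def
    using finite_vimageI[OF fin, of "\<lambda>y. (i, x', y)"] by (simp add: inj_def vimage_def)
  have fins: "finite (supp A i)"
    by (rule finite_subset[OF _ finite_imageI[OF fin, of xcoord]])
      (force simp: supp_def image_iff)
  have "A \<inter> W m P Q i \<subseteq> Pair i ` (SIGMA x' : supp A i. fibre A i x')"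
    by (auto simp: supp_def fibre_def W_def)
  then have "card (A \<inter> W m P Q i) \<le> card (Pair i ` (SIGMA x' : supp A i. fibre A i x'))"
    using fins finf by (intro card_mono) auto
  also have "\<dots> = (\<Sum>x'\<in>supp A i. card (fibre A i x'))"
    using fins finf by (simp add: card_image inj_on_def)
  also have "\<dots> = card (fibre A i x) + (\<Sum>x'\<in>supp A i - {x}. card (fibre A i x'))"
    using fins x by (rule sum.remove)
  also have "(\<Sum>x'\<in>supp A i - {x}. card (fibre A i x')) \<le> (\<Sum>x'\<in>supp A i - {x}. 1)"
    using assms(1) A finf max by (intro sum_mono card_fibre_le_1[of i m G P Q A x]) auto
  also have "\<dots> = card (supp A i) - 1"
    using fins x by simp
  finally show ?thesis
    using fins x card_gt_0_iff[of "supp A i"] by auto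
qed

theorem theorem1:
  fixes m :: nat
    and G :: "nat \<Rightarrow> 'a hypergraph"
    and P Q :: "nat \<Rightarrow> 'a set"
    and a :: "nat \<Rightarrow> int"
  assumes "m \<ge> 2"
    and "\<And>i. i < m \<Longrightarrow> four_graph (G i)"
    and "\<And>i. i < m \<Longrightarrow> verts (G i) = P i \<union> Q i"
    and "\<And>i. i < m \<Longrightarrow> P i \<inter> Q i = {}"
    and "\<And>i. i < m \<Longrightarrow> int (independence_number (G i)) = a i + 1"
    and "\<And>i. i < m \<Longrightarrow> int (independence_number (induced (G i) (P i))) \<le> a i"
  shows "int (independence_number (circular m G P Q)) \<le> (\<Sum>i<m. a i)"
proof -
  have four: "four_graph (circular m G P Q)"
    using assms(1-3) by (rule four_graph_circular)
  then obtain A where A: "independent (circular m G P Q) A"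
    and cardA: "card A = independence_number (circular m G P Q)"
    by (rule independence_number_attained)
  have AV: "A \<subseteq> (\<Union>i<m. W m P Q i)"
    using A by (simp add: independent_def circular_def)
  have fin: "finite A"
    using A four by (auto simp: independent_def four_graph_def intro: finite_subset)
  have finV: "finite (verts (G i))" if "i < m" for i
    using assms(2)[OF that] by (simp add: four_graph_def)
  have suppP: "supp A i \<subseteq> P i" for i
    using AV by (auto simp: supp_def W_def)
  \<comment> \<open>\<open>supp A i\<close> lies in \<open>P i\<close>, so the hypothesis on the
    induced graph gives a bound one better than \<alpha>(G_i).\<close>
  have supp_le: "int (card (supp A i)) \<le> a i" if "i < m" for i
  proof -
    have "independent (induced (G i) (P i)) (supp A i)"
      using independent_supp[OF assms(2,3)[OF that] that A] suppP by (rule independent_induced)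
    moreover have "finite (verts (induced (G i) (P i)))"
      using finV[OF that] by (simp add: induced_def)
    ultimately show ?thesis
      using assms(6)[OF that] card_le_independence_number by fastforce
  qed
  have step: "int (card (A \<inter> W m P Q i)) \<le>
      int (card (supp A i)) + (a (nxt m i) - int (card (supp A (nxt m i))))" if "i < m" for i
  proof (cases "supp A i = {}")
    \<comment> \<open>With no fibre to work with, the left side is 0, and the sharper bound
      \<open>supp_le\<close> at \<open>nxt m i\<close> makes the right side nonnegative.\<close>
    case True
    then have "A \<inter> W m P Q i = {}"
      by (auto simp: supp_def W_def)
    then show ?thesis
      using supp_le[of "nxt m i"] assms(1) by (simp add: nxt_def)
  next
    case False
    define j where "j = nxt m i"
    have j: "j < m"
      using assms(1) by (simp add: j_def nxt_def)
    have fins: "finite (supp A k)" if "k < m" for k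
      using suppP[of k] finV[OF that] assms(3)[OF that] by (auto intro: finite_subset)
    have "Max ((\<lambda>x. card (fibre A i x)) ` supp A i) \<in> (\<lambda>x. card (fibre A i x)) ` supp A i"
      using fins[OF that] False by (intro Max_in) auto
    then obtain x where x: "x \<in> supp A i"
      and "card (fibre A i x) = Max ((\<lambda>x. card (fibre A i x)) ` supp A i)"
      by (metis imageE)
    then have max: "card (fibre A i x') \<le> card (fibre A i x)" if "x' \<in> supp A i" for x'
      using that fins[OF \<open>i < m\<close>] by simp
    have Y: "fibre A i x \<subseteq> Q j"
      using AV by (auto simp: fibre_def W_def j_def)
    then have "finite (fibre A i x)"
      using finV[OF j] assms(3)[OF j] by (auto intro: finite_subset)
    \<comment> \<open>The two sets lie in different parts of \<open>G j\<close>, so their sizes add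
      up to at most \<alpha>(G_j), which is \<open>a j + 1\<close>. This 1 cancels the one in
      \<open>card_W_le\<close>.\<close>
    moreover have "fibre A i x \<inter> supp A j = {}"
      using Y suppP[of j] assms(4)[OF j] by blast
    ultimately have "card (fibre A i x) + card (supp A j) = card (fibre A i x \<union> supp A j)"
      using fins[OF j] by (simp add: card_Un_disjoint)
    also have "\<dots> \<le> independence_number (G j)"
      using finV[OF j] independent_fibre_supp[OF assms(1) that j_def assms(2,3)[OF j] A]
      by (rule card_le_independence_number)
    finally have "int (card (fibre A i x)) + int (card (supp A j)) \<le> a j + 1"
      using assms(5)[OF j] by simp
    then show ?thesis
      using card_W_le[OF that A fin x max] unfolding j_def by linarith
  qed
  have "A = (\<Union>i<m. A \<inter> W m P Q i)"
    using AV by auto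
  then have "card A \<le> (\<Sum>i<m. card (A \<inter> W m P Q i))"
    using card_UN_le[of "{..<m}" "\<lambda>i. A \<inter> W m P Q i"] by simp
  then have "int (card A) \<le> (\<Sum>i<m. int (card (A \<inter> W m P Q i)))"
    by (simp flip: of_nat_sum)
  also have "\<dots> \<le> (\<Sum>i<m. int (card (supp A i)) +
      (a (nxt m i) - int (card (supp A (nxt m i)))))"
    using step by (intro sum_mono) simp
  \<comment> \<open>Reindexing along the rotation cancels the support sizes and turns the shifted
    sum of \<open>a\<close> into the plain one.\<close>
  also have "\<dots> = (\<Sum>i<m. a i)"
    using sum_nxt[of a m] sum_nxt[of "\<lambda>i. int (card (supp A i))" m]
    by (simp add: sum.distrib sum_subtractf)
  finally show ?thesis
    using cardA by simp
qed

end
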